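(* Let $K\ge 1$ and consider the canonical data shuffling problem with a master node, $K$ worker nodes, $N=K$ files, and a cache of size $S$ files at each worker node. For a permutation $d$ of $[K]$ let $\gamma(d)$ be the number of cycles of its file transition graph. For every integer $S\in[N]$, the family of loads $$\rho_d(S)=\frac{\binom{K-1}{S}-\binom{\gamma(d)-1}{S}}{\binom{K-1}{S-1}},\qquad d \text{ a permutation of } [K],$$ is achievable with cache size $S$; i.e. the shuffling for a file transition graph comprising $\gamma$ cycles can be performed by broadcasting a message of size $R\le \big(\binom{K-1}{S}-\binom{\gamma-1}{S}\big)/\binom{K-1}{S-1}$. For non-integer $S$ with $1\le S\le N$, the family whose $d$-th member is the value at $S$ of the lower convex envelope of the $N$ corner points $(s,\rho_d(s))$, $s\in[N]$, is achievable.
   Context: Notation: $[K]=\{1,\dots,K\}$; $\binom{n}{k}=0$ when $n<k$. Canonical data shuffling problem ($N=K$). There are $K$ files $F^1,\dots,F^K$, each a string of $B$ bits ($B$ a positive integer; the files are independent and uniformly distributed); the size of a file is normalized to $1$, i.e. all sizes are measured in units of $B$ bits. There are $K$ worker nodes $W_1,\dots,W_K$ and a master node that knows all files. At iteration $t$, worker $W_i$ processes file $F^i$ and stores it completely. Each worker has a cache of size $S$ files, where $1\le S\le K$ is real. An uncoded placement (with cache size $S$ and file length $B$) specifies, for every ordered pair $i\ne j$ in $[K]$, a set $\widetilde F^i_j$ of bits (bit positions) of $F^i$ stored in the excess storage of $W_j$, such that $\sum_{i\neq j}|\widetilde F^i_j|\le (S-1)B$ for every $j$. The cache content of $W_j$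 is $\mathcal Z_j=F^j\cup\bigcup_{i\ne j}\widetilde F^i_j$. The placement is chosen without knowledge of the next assignment. The next assignment is a permutation $d$ of $[K]$: at iteration $t+1$ worker $W_i$ must process $F^{d(i)}$. A delivery for $d$ of load $L/B$ is a function $\mathcal X$ of all files with values in $\{0,1\}^L$ (broadcast by the master to all workers without error) such that for every $i\in[K]$ the file $F^{d(i)}$ is a function of $(\mathcal X,\mathcal Z_i)$. The file transition graph of $d$ is the directed graph on the workers with one edge per file, the edge of file $F^j$ going from the worker processing $F^j$ at iteration $t$ (namely $W_j$) to the worker assigned $F^j$ at iteration $t+1$ (namely $W_{d^{-1}(j)}$). It is a disjoint union of directed cycles (loops count as cycles of length 1), so its number of cycles is the number of cycles of $d$, fixed points included. A family of loads $(\rho_d)_d$, indexed by all permutations $d$ of $[K]$, is achievable with cache size $S$ if for every $\varepsilon>0$ there exist $B$ and one single uncoded placement (independent of $d$) such that for every $d$ there is a delivery for $d$ of load at most $\rho_d+\varepsilon$. *)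

theory Defs
  imports "HOL-Analysis.Analysis" "HOL-Combinatorics.Permutations" "Graph_Theory.Arc_Walk"
begin

text \<open>
  Workers and files are both indexed by \<open>{1..K}\<close>; \<open>F i\<close> is the bit string of the \<open>i\<close>-th file, and
  bit positions are \<open>0, \<dots>, B - 1\<close>.
\<close>

definition bit_strings :: "nat \<Rightarrow> bool list set" where
  "bit_strings n = {xs. length xs = n}"

definition file_contents :: "nat \<Rightarrow> nat \<Rightarrow> (nat \<Rightarrow> bool list) set" where
  "file_contents K B = (\<Pi>\<^sub>E i\<in>{1..K}. bit_strings B)"

text \<open>
  \<open>C i j\<close>, for \<open>i \<noteq> j\<close>, is the set of positions of those bits of file \<open>i\<close> that are in the excess
  storage of worker \<open>j\<close>. The values \<open>C j j\<close> play no role: worker \<open>j\<close> stores all of file \<open>j\<close>.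
\<close>

definition uncoded_placement ::
    "nat \<Rightarrow> real \<Rightarrow> nat \<Rightarrow> (nat \<Rightarrow> nat \<Rightarrow> nat set) \<Rightarrow> bool" where
  "uncoded_placement K S B C \<longleftrightarrow>
     (\<forall>i\<in>{1..K}. \<forall>j\<in>{1..K}. i \<noteq> j \<longrightarrow> C i j \<subseteq> {..<B}) \<and>
     (\<forall>j\<in>{1..K}. (\<Sum>i\<in>{1..K} - {j}. real (card (C i j))) \<le> (S - 1) * real B)"

definition cache_content ::
    "nat \<Rightarrow> (nat \<Rightarrow> nat \<Rightarrow> nat set) \<Rightarrow> nat \<Rightarrow> (nat \<Rightarrow> bool list) \<Rightarrow> (nat \<Rightarrow> bool list)" where
  "cache_content K C j F = (\<lambda>i\<in>{1..K}. if i = j then F j else nths (F i) (C i j))"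

definition delivery ::
    "nat \<Rightarrow> nat \<Rightarrow> (nat \<Rightarrow> nat \<Rightarrow> nat set) \<Rightarrow> (nat \<Rightarrow> nat) \<Rightarrow> nat
      \<Rightarrow> ((nat \<Rightarrow> bool list) \<Rightarrow> bool list) \<Rightarrow> bool" where
  "delivery K B C d L X \<longleftrightarrow>
     X \<in> file_contents K B \<rightarrow> bit_strings L \<and>
     (\<forall>i\<in>{1..K}. \<exists>\<psi>. \<forall>F\<in>file_contents K B. F (d i) = \<psi> (X F) (cache_content K C i F))"

definition achievable :: "nat \<Rightarrow> real \<Rightarrow> ((nat \<Rightarrow> nat) \<Rightarrow> real) \<Rightarrow> bool" where
  "achievable K S \<rho> \<longleftrightarrow>
     (\<forall>\<epsilon>>0. \<exists>B>0. \<exists>C. uncoded_placement K S B C \<and>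
        (\<forall>d. d permutes {1..K} \<longrightarrow>
           (\<exists>L X. delivery K B C d L X \<and> real L / real B \<le> \<rho> d + \<epsilon>)))"

text \<open>The arcs are the files, so parallel arcs and loops are represented.\<close>

definition file_transition_graph :: "nat \<Rightarrow> (nat \<Rightarrow> nat) \<Rightarrow> (nat, nat) pre_digraph" where
  "file_transition_graph K d =
     \<lparr>verts = {1..K}, arcs = {1..K}, tail = (\<lambda>j. j), head = (\<lambda>j. inv d j)\<rparr>"

text \<open>
  The library's \<open>cycle\<close> is a property of arc lists: it admits loops, and the rotations of a cycle
  are different lists. Cycles are therefore counted by their sets of arcs.
\<close>

definition num_cycles :: "('a, 'b) pre_digraph \<Rightarrow> nat" where
  "num_cycles G = card (set ` {p. pre_digraph.cycle G p})"

definition corner_load :: "nat \<Rightarrow> (nat \<Rightarrow> nat) \<Rightarrow> nat \<Rightarrow> real" where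
  "corner_load K d s =
     (real ((K - 1) choose s) - real ((num_cycles (file_transition_graph K d) - 1) choose s))
       / real ((K - 1) choose (s - 1))"

text \<open>The lower boundary of the convex hull of a set of points of the plane.\<close>

definition lower_convex_envelope :: "(real \<times> real) set \<Rightarrow> real \<Rightarrow> real" where
  "lower_convex_envelope P x = Inf {y. (x, y) \<in> convex hull P}"

end

theory Submission
  imports Defs "HOL-Library.Z2" "HOL-Combinatorics.Orbits"
begin

text \<open>
  Split file \<open>i\<close> into subfiles \<open>F i G\<close>, one for each \<open>(s - 1)\<close>-set \<open>G\<close> of workers other than \<open>i\<close>, and
  let the workers in \<open>G\<close> cache it. Over the field with two elements put
  \<open>Y T = (\<Sum>i. F (d i) (T - {i, d i}))\<close>, summed over the arcs \<open>(i, d i)\<close> with distinct ends in the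
  \<open>(s + 1)\<close>-set \<open>T\<close>, and let \<open>X = \<partial>Y\<close>, that is, \<open>X D = (\<Sum>j\<notin>D. Y (insert j D))\<close> for \<open>s\<close>-sets \<open>D\<close>. If
  \<open>m \<in> D\<close> and \<open>d m \<notin> D\<close>, then \<open>F (d m) (D - {m})\<close> is the only term of \<open>X D\<close> unknown to worker \<open>m\<close>, so all
  the \<open>X D\<close> together suffice. There are two kinds of linear relations among them. Since \<open>\<partial>X = 0\<close>,
  the \<open>X D\<close> with \<open>1 \<notin> D\<close> determine the others; this leaves \<open>K - 1 choose s\<close> of them. Moreover, for each
  choice of \<open>s\<close> cycles of \<open>d\<close> the sum of \<open>X D\<close> over all transversals \<open>D\<close> of these cycles vanishes, so one
  of them can be omitted; this saves \<open>\<gamma> - 1 choose s\<close> more.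

  With \<open>n = K - 1\<close>, the load at \<open>s\<close> is the sum over \<open>\<gamma> - 1 \<le> m < n\<close> of
  \<open>(m choose (s - 1)) / (n choose (s - 1)) = ((n + 1 - s) choose (n - m)) / (n choose m)\<close>,
  which is convex in \<open>s\<close>. Hence for every \<open>d\<close> the lower convex envelope is linear between consecutive
  corner points, and one memory sharing between the two placements serves all \<open>d\<close> at once.
\<close>

section \<open>Messages over the field with two elements\<close>

text \<open>In characteristic two equal terms cancel, and a fixed-point-free involution splits
  \<open>A\<close> into pairs of equal terms; the induction removes one pair at a time.\<close>

lemma sum_bit_involution:
  fixes g :: "'a \<Rightarrow> bit"
  assumes "finite A"
    and "\<And>x. x \<in> A \<Longrightarrow> \<phi> x \<in> A"
    and "\<And>x. x \<in> A \<Longrightarrow> \<phi> (\<phi> x) = x"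
    and "\<And>x. x \<in> A \<Longrightarrow> \<phi> x \<noteq> x"
    and "\<And>x. x \<in> A \<Longrightarrow> g (\<phi> x) = g x"
  shows "sum g A = 0"
  using assms
proof (induction A rule: finite_psubset_induct)
  case (psubset A)
  show ?case
  proof (cases "A = {}")
    case False
    then obtain x where x: "x \<in> A" by blast
    let ?B = "A - {x, \<phi> x}"
    have "\<phi> y \<in> ?B" if "y \<in> ?B" for y
      using that psubset.prems(1,2) x by (metis DiffD1 DiffD2 DiffI insert_iff singletonD)
    then have "sum g ?B = 0"
      using psubset.prems x by (intro psubset.IH) auto
    moreover have "sum g A = sum g ?B + sum g {x, \<phi> x}"
      using psubset.hyps psubset.prems(1) x by (intro sum.subset_diff) auto
    moreover have "sum g {x, \<phi> x} = 0"
      using psubset.prems(3,4)[OF x] by (cases "g x") auto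
    ultimately show ?thesis by simp
  qed simp
qed

text \<open>The chain \<open>Y\<close> of the overview, with \<open>f i G\<close> for the subfile of
  file \<open>i\<close> cached by \<open>G\<close>, a single bit. Its boundary \<open>X\<close> is
  \<open>message\<close>.\<close>

definition pair_sum :: "('a \<Rightarrow> 'a) \<Rightarrow> ('a \<Rightarrow> 'a set \<Rightarrow> bit) \<Rightarrow> 'a set \<Rightarrow> bit" where
  "pair_sum d f T = (\<Sum>i\<in>{i \<in> T. d i \<in> T \<and> d i \<noteq> i}. f (d i) (T - {i, d i}))"

definition message :: "'a set \<Rightarrow> ('a \<Rightarrow> 'a) \<Rightarrow> ('a \<Rightarrow> 'a set \<Rightarrow> bit) \<Rightarrow> 'a set \<Rightarrow> bit" where
  "message V d f D = (\<Sum>j\<in>V - D. pair_sum d f (insert j D))"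

text \<open>By linearity, decoding amounts to showing that the difference of two file contents with
  equal messages and equal caches vanishes on the requested file.\<close>

lemma message_add:
  "message V d (\<lambda>i G. f i G + g i G) D = message V d f D + message V d g D"
  unfolding message_def pair_sum_def sum.distrib ..

text \<open>This is \<open>\<partial>\<partial> = 0\<close>.\<close>

lemma sum_message_supersets:
  assumes "finite V"
  shows "(\<Sum>j\<in>V - T. message V d f (insert j T)) = 0"
proof -
  let ?P = "SIGMA j:V - T. V - insert j T"
  have "(\<Sum>j\<in>V - T. message V d f (insert j T)) =
      (\<Sum>(j, k)\<in>?P. pair_sum d f (insert k (insert j T)))"
    using assms by (simp add: message_def sum.Sigma)
  also have "\<dots> = 0"
    using assms by (intro sum_bit_involution[where \<phi> = prod.swap]) (auto simp: insert_commute)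
  finally show ?thesis .
qed

lemma orbit_permutes_apply:
  assumes "finite V" "d permutes V"
  shows "orbit d (d x) = orbit d x"
  using assms cyclic_on_orbit' orbit_cyclic_eq3 orbit.base permutation_permutes by metis

text \<open>Each \<open>D\<close> in the index set has as many elements as \<open>Q\<close>, hence
  meets every cycle in \<open>Q\<close> exactly once.\<close>

lemma sum_message_transversals:
  assumes V: "finite V" and d: "d permutes V"
  shows "(\<Sum>D\<in>{D. D \<subseteq> V \<and> card D = card Q \<and> orbit d ` D = Q}. message V d f D) = 0"
proof -
  define T where "T = {D. D \<subseteq> V \<and> card D = card Q \<and> orbit d ` D = Q}"
  define I where "I D = (SIGMA j:V - D. {i \<in> insert j D. d i \<in> insert j D \<and> d i \<noteq> i})" for D
  define P where "P = (SIGMA D:T. I D)"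
  define g where "g = (\<lambda>(D, j, i). f (d i) (insert j D - {i, d i}))"
  \<comment> \<open>In a term of the sum, \<open>i\<close> and \<open>d i\<close> lie on one cycle, so one of them is in \<open>D\<close> and the other is \<open>j\<close>;
      exchanging their roles pairs off equal terms.\<close>
  define \<phi> where "\<phi> = (\<lambda>(D, j, i). let k = if j = i then d i else i in (insert j D - {k}, k, i))"
  have finT: "finite T" using V by (auto simp: T_def intro: rev_finite_subset[of "Pow V"])
  have finD: "finite D" if "D \<in> T" for D using that V by (auto simp: T_def intro: finite_subset)
  have finI: "finite (I D)" if "D \<in> T" for D
    unfolding I_def using V finD[OF that] by (intro finite_SigmaI) auto
  have inj: "inj_on (orbit d) D" if "D \<in> T" for D
    using that finD[OF that] by (intro eq_card_imp_inj_on) (auto simp: T_def)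
  have orb: "orbit d (d i) = orbit d i" for i
    by (rule orbit_permutes_apply[OF V d])
  have "sum (message V d f) T = (\<Sum>D\<in>T. sum (\<lambda>p. g (D, p)) (I D))"
  proof (rule sum.cong[OF refl])
    fix D assume D: "D \<in> T"
    show "message V d f D = sum (\<lambda>p. g (D, p)) (I D)"
      unfolding message_def pair_sum_def I_def using V finD[OF D]
      by (subst sum.Sigma) (auto simp: g_def)
  qed
  also have "\<dots> = sum g P"
    unfolding P_def using finT finI by (subst sum.Sigma) auto
  also have "\<dots> = 0"
  proof -
    have key: "\<phi> x \<in> P \<and> \<phi> (\<phi> x) = x \<and> \<phi> x \<noteq> x \<and> g (\<phi> x) = g x" if "x \<in> P" for x
    proof -
      obtain D j i where x: "x = (D, j, i)" by (cases x) auto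
      have D: "D \<in> T" and j: "j \<in> V" "j \<notin> D" and i: "i \<in> insert j D" "d i \<in> insert j D" "d i \<noteq> i"
        using that by (auto simp: x P_def I_def)
      have ij: "j = i \<or> j = d i"
        using i inj[OF D] orb[of i] by (auto dest: inj_onD)
      define k where "k = (if j = i then d i else i)"
      have k: "k \<in> D" "k \<noteq> j" "orbit d k = orbit d j" "{j, k} = {i, d i}"
        using i ij orb[of i] by (auto simp: k_def split: if_splits)
      define D' where "D' = insert j D - {k}"
      have ins: "insert k D' = insert j D" using k by (auto simp: D'_def)
      have D'alt: "D' = insert j (D - {k})" using k by (auto simp: D'_def)
      have "card D' = card D"
        using k j finD[OF D] unfolding D'alt by (metis Diff_iff card.insert card_Suc_Diff1 finite_Diff)
      moreover have "orbit d ` D' = orbit d ` D"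
      proof -
        have "orbit d ` D = insert (orbit d k) (orbit d ` (D - {k}))"
          using k(1) by blast
        then show ?thesis using k(3) by (simp add: D'alt)
      qed
      moreover have "D' \<subseteq> V" using D j by (auto simp: D'_def T_def)
      ultimately have D'T: "D' \<in> T" using D by (simp add: T_def)
      have \<phi>: "\<phi> (D, j, i) = (D', k, i)" by (simp add: \<phi>_def k_def D'_def Let_def)
      \<comment> \<open>With \<open>k\<close> in the place of \<open>j\<close>, the rule for the
        removed vertex gives back \<open>j\<close>; hence \<open>\<phi>\<close> is an
        involution.\<close>
      have kk: "(if k = i then d i else i) = j" using ij i by (auto simp: k_def)
      have "insert k D' - {j} = D" using ins j by auto
      then have \<phi>': "\<phi> (D', k, i) = (D, j, i)" by (simp add: \<phi>_def Let_def kk)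
      have "(D', k, i) \<in> P"
        unfolding P_def I_def
      proof (intro SigmaI)
        show "k \<in> V - D'" using k(1) D by (auto simp: D'_def T_def)
        show "i \<in> {i \<in> insert k D'. d i \<in> insert k D' \<and> d i \<noteq> i}"
          unfolding ins using i by simp
      qed (rule D'T)
      moreover have "g (D', k, i) = g (D, j, i)" by (simp add: g_def ins)
      ultimately show ?thesis using \<phi> \<phi>' k by (simp add: x)
    qed
    have "finite P" unfolding P_def using finT finI by auto
    then show ?thesis using key by (intro sum_bit_involution[where \<phi> = \<phi>]) auto
  qed
  finally show ?thesis by (simp add: T_def)
qed

text \<open>Think of \<open>g\<close> as the difference of two contents that look alike to worker
  \<open>m\<close>. An arc \<open>(i, d i)\<close> with \<open>i \<noteq> m\<close> contributes
  zero: if \<open>d i = m\<close>, its subfile belongs to file \<open>m\<close>; otherwise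
  \<open>m\<close> stays in the index set and the subfile is cached. The arc leaving
  \<open>m\<close> counts only when \<open>j\<close> supplies its missing end
  \<open>d m\<close>.\<close>

lemma message_reveals_subfile:
  assumes V: "finite V" and d: "d permutes V"
    and D: "D \<subseteq> V" "m \<in> D" "d m \<notin> D"
    and cached: "\<And>i G. m \<in> G \<Longrightarrow> g i G = 0"
    and own: "\<And>G. g m G = 0"
  shows "message V d g D = g (d m) (D - {m})"
proof -
  have eq: "pair_sum d g (insert j D) = (if j = d m then g (d m) (D - {m}) else 0)"
    if "j \<in> V - D" for j
  proof -
    let ?I = "{i \<in> insert j D. d i \<in> insert j D \<and> d i \<noteq> i}"
    have "finite D" using V D finite_subset by blast
    then have fin: "finite ?I" by auto
    have "pair_sum d g (insert j D) =
        (\<Sum>i\<in>?I. if i = m then g (d m) (insert j D - {m, d m}) else 0)"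
      unfolding pair_sum_def
    proof (rule sum.cong[OF refl])
      fix i assume "i \<in> ?I"
      then show "g (d i) (insert j D - {i, d i}) =
          (if i = m then g (d m) (insert j D - {m, d m}) else 0)"
        using cached[of "insert j D - {i, d i}" "d i"] own D(2) by auto
    qed
    also have "\<dots> = (if m \<in> ?I then g (d m) (insert j D - {m, d m}) else 0)"
      by (rule sum.delta[OF fin])
    also have "\<dots> = (if j = d m then g (d m) (D - {m}) else 0)"
    proof -
      have "insert (d m) D - {m, d m} = D - {m}" "d m \<noteq> m" using D by auto
      then show ?thesis using D by auto
    qed
    finally show ?thesis .
  qed
  have dm: "d m \<in> V - D" using D d by (simp add: permutes_in_image subset_iff)
  have "message V d g D = (\<Sum>j\<in>V - D. if j = d m then g (d m) (D - {m}) else 0)"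
    unfolding message_def by (rule sum.cong[OF refl]) (rule eq)
  then show ?thesis using dm V by (simp add: sum.delta)
qed

text \<open>\<open>R\<close> has at most one worker from each cycle and none from that of
  \<open>l\<close>. A set \<open>D\<close> inside \<open>R\<close> is a transversal of its cycles;
  every other transversal of them avoids \<open>l\<close> and leaves \<open>R\<close>, so the
  transversal relation yields the message of \<open>D\<close>. Sets containing \<open>l\<close> then
  follow from \<partial>\<partial> = 0.\<close>

lemma messages_vanish:
  assumes V: "finite V" and d: "d permutes V" and l: "l \<in> V"
    and R: "R \<subseteq> V" "inj_on (orbit d) R" "orbit d l \<notin> orbit d ` R"
    and sent: "\<And>D. D \<subseteq> V - {l} \<Longrightarrow> card D = s \<Longrightarrow> \<not> D \<subseteq> R \<Longrightarrow> message V d g D = 0"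
    and D: "D \<subseteq> V" "card D = s"
  shows "message V d g D = 0"
proof -
  have avoid: "message V d g D = 0" if D: "D \<subseteq> V - {l}" "card D = s" for D
  proof (cases "D \<subseteq> R")
    case True
    let ?Q = "orbit d ` D"
    let ?T = "{D'. D' \<subseteq> V \<and> card D' = card ?Q \<and> orbit d ` D' = ?Q}"
    have card: "card ?Q = s"
      using True R D card_image inj_on_subset by metis
    have fin: "finite ?T" using V by (auto intro: rev_finite_subset[of "Pow V"])
    have "D \<in> ?T" using D card by auto
    have "message V d g D' = 0" if D': "D' \<in> ?T - {D}" for D'
    proof (rule sent)
      have "l \<notin> D'"
      proof
        assume "l \<in> D'"
        then have "orbit d l \<in> ?Q" using D' by auto
        then show False using True R(3) by auto
      qed
      then show "D' \<subseteq> V - {l}" using D' by auto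
      show "card D' = s" using D' card by simp
      show "\<not> D' \<subseteq> R"
        using D' True R(2) inj_on_image_eq_iff by (metis (mono_tags, lifting) DiffD1 DiffD2 mem_Collect_eq singletonI)
    qed
    then have "sum (message V d g) ?T = message V d g D"
      using fin \<open>D \<in> ?T\<close> by (subst sum.remove[of _ D]) auto
    then show ?thesis using sum_message_transversals[OF V d, where Q = ?Q and f = g] by simp
  qed (use D sent in auto)
  show ?thesis
  proof (cases "l \<in> D")
    case True
    let ?G = "D - {l}"
    have fin: "finite D" using V D finite_subset by blast
    have "message V d g (insert j ?G) = 0" if "j \<in> V - ?G - {l}" for j
    proof (rule avoid)
      show "insert j ?G \<subseteq> V - {l}" using that D by auto
      show "card (insert j ?G) = s"
        using that D(2) fin True by (metis DiffD1 DiffD2 card.insert card_Suc_Diff1 finite_Diff)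
    qed
    then have "(\<Sum>j\<in>V - ?G. message V d g (insert j ?G)) = message V d g (insert l ?G)"
      using V l by (subst sum.remove[of _ l]) auto
    then show ?thesis
      using sum_message_supersets[OF V, where d = d and f = g and T = ?G] True by (simp add: insert_absorb)
  qed (use avoid D in auto)
qed

section \<open>Delivery schemes and their concatenation\<close>

lemma nths_eq_iff:
  assumes "length xs = length ys" "A \<subseteq> {..<length xs}"
  shows "nths xs A = nths ys A \<longleftrightarrow> (\<forall>b\<in>A. xs ! b = ys ! b)"
  using assms
proof (induction xs ys arbitrary: A rule: list_induct2)
  case (Cons x xs y ys)
  let ?A = "{j. Suc j \<in> A}"
  have all_nat_split: "(\<forall>n. P n) \<longleftrightarrow> P 0 \<and> (\<forall>n. P (Suc n))" for P
    by (metis not0_implies_Suc)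
  have "nths xs ?A = nths ys ?A \<longleftrightarrow> (\<forall>b\<in>?A. xs ! b = ys ! b)"
    using Cons.prems by (intro Cons.IH) auto
  moreover have "(\<forall>b\<in>A. (x # xs) ! b = (y # ys) ! b) \<longleftrightarrow>
      (0 \<in> A \<longrightarrow> x = y) \<and> (\<forall>b\<in>?A. xs ! b = ys ! b)"
    unfolding Ball_def by (subst all_nat_split) simp
  ultimately show ?case by (auto simp: nths_Cons)
qed auto

text \<open>The real-valued cache bound is left out because \<open>scheme\<close> counts cached bits
  in natural numbers.\<close>

definition excess_placement :: "nat \<Rightarrow> nat \<Rightarrow> (nat \<Rightarrow> nat \<Rightarrow> nat set) \<Rightarrow> bool" where
  "excess_placement K B C \<longleftrightarrow> (\<forall>i\<in>{1..K}. \<forall>j\<in>{1..K}. i \<noteq> j \<longrightarrow> C i j \<subseteq> {..<B})"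

definition same_cache ::
    "nat \<Rightarrow> (nat \<Rightarrow> nat \<Rightarrow> nat set) \<Rightarrow> nat \<Rightarrow> (nat \<Rightarrow> bool list) \<Rightarrow> (nat \<Rightarrow> bool list) \<Rightarrow> bool" where
  "same_cache K C i F F' \<longleftrightarrow>
     F i = F' i \<and> (\<forall>j\<in>{1..K} - {i}. \<forall>b\<in>C j i. F j ! b = F' j ! b)"

lemma length_file_contents: "F \<in> file_contents K B \<Longrightarrow> i \<in> {1..K} \<Longrightarrow> length (F i) = B"
  by (auto simp: file_contents_def bit_strings_def)

lemma cache_content_eq_iff:
  assumes C: "excess_placement K B C" and F: "F \<in> file_contents K B" "F' \<in> file_contents K B"
    and i: "i \<in> {1..K}"
  shows "cache_content K C i F = cache_content K C i F' \<longleftrightarrow> same_cache K C i F F'"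
proof -
  have "nths (F j) (C j i) = nths (F' j) (C j i) \<longleftrightarrow> (\<forall>b\<in>C j i. F j ! b = F' j ! b)"
    if "j \<in> {1..K} - {i}" for j
    using that C i length_file_contents[OF F(1), of j] length_file_contents[OF F(2), of j]
    by (intro nths_eq_iff) (auto simp: excess_placement_def)
  moreover have "cache_content K C i F = cache_content K C i F' \<longleftrightarrow>
      (\<forall>j\<in>{1..K}. cache_content K C i F j = cache_content K C i F' j)"
    by (rule iffI) (auto simp: cache_content_def fun_eq_iff restrict_def)
  moreover have "\<dots> \<longleftrightarrow>
      F i = F' i \<and> (\<forall>j\<in>{1..K} - {i}. nths (F j) (C j i) = nths (F' j) (C j i))"
    using i by (auto simp: cache_content_def)
  ultimately show ?thesis by (simp add: same_cache_def)
qed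

text \<open>The decoder picks any input consistent with what is observed. Decodability thus becomes
  a statement about pairs of file contents, and no decoder has to be written down.\<close>

lemma factors_through_iff:
  "(\<exists>\<psi>. \<forall>x\<in>A. f x = \<psi> (g x) (h x)) \<longleftrightarrow>
     (\<forall>x\<in>A. \<forall>y\<in>A. g x = g y \<longrightarrow> h x = h y \<longrightarrow> f x = f y)"
proof (intro iffI)
  assume R: "\<forall>x\<in>A. \<forall>y\<in>A. g x = g y \<longrightarrow> h x = h y \<longrightarrow> f x = f y"
  define \<psi> where "\<psi> a b = f (SOME x. x \<in> A \<and> g x = a \<and> h x = b)" for a b
  have "f x = \<psi> (g x) (h x)" if "x \<in> A" for x
  proof -
    have "\<exists>y. y \<in> A \<and> g y = g x \<and> h y = h x" using that by blast
    from someI_ex[OF this] show ?thesis using R that unfolding \<psi>_def by metis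
  qed
  then show "\<exists>\<psi>. \<forall>x\<in>A. f x = \<psi> (g x) (h x)" by blast
qed auto

lemma delivery_iff:
  assumes C: "excess_placement K B C"
  shows "delivery K B C d L X \<longleftrightarrow>
     X \<in> file_contents K B \<rightarrow> bit_strings L \<and>
     (\<forall>i\<in>{1..K}. \<forall>F\<in>file_contents K B. \<forall>F'\<in>file_contents K B.
        X F = X F' \<longrightarrow> same_cache K C i F F' \<longrightarrow> F (d i) = F' (d i))"
  unfolding delivery_def factors_through_iff
  using cache_content_eq_iff[OF C] by blast

text \<open>
  \<open>M\<close> bounds the number of bits in the excess storage of each worker, and \<open>l d\<close> the length of the
  message for \<open>d\<close>.
\<close>

definition scheme :: "nat \<Rightarrow> nat \<Rightarrow> nat \<Rightarrow> ((nat \<Rightarrow> nat) \<Rightarrow> nat) \<Rightarrow> bool" where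
  "scheme K B M l \<longleftrightarrow>
     (\<exists>C. excess_placement K B C \<and>
        (\<forall>j\<in>{1..K}. (\<Sum>i\<in>{1..K} - {j}. card (C i j)) \<le> M) \<and>
        (\<forall>d. d permutes {1..K} \<longrightarrow> (\<exists>L\<le>l d. \<exists>X. delivery K B C d L X)))"

text \<open>For \<open>B = 0\<close> every file is the empty string. Length zero is allowed so that
  this can start the induction for multiples of a scheme.\<close>

lemma scheme_empty: "scheme K 0 0 (\<lambda>d. 0)"
proof -
  have "excess_placement K 0 (\<lambda>i j. {})" by (simp add: excess_placement_def)
  moreover from this have "delivery K 0 (\<lambda>i j. {}) d 0 (\<lambda>F. [])" if d: "d permutes {1..K}" for d
  proof -
    have "F (d i) = F' (d i)"
      if "i \<in> {1..K}" "F \<in> file_contents K 0" "F' \<in> file_contents K 0" for i F F'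
    proof -
      have "d i \<in> {1..K}" using d that(1) permutes_in_image by metis
      then show ?thesis using length_file_contents[OF that(2)] length_file_contents[OF that(3)] by simp
    qed
    then show ?thesis
      unfolding delivery_iff[OF \<open>excess_placement K 0 (\<lambda>i j. {})\<close>] by (auto simp: bit_strings_def)
  qed
  ultimately show ?thesis unfolding scheme_def by (intro exI[of _ "\<lambda>i j. {}"]) auto
qed

text \<open>One scheme serves the first \<open>B1\<close> bits of every file, the other the
  remaining \<open>B2\<close> bits. The concatenated messages can be separated again because the
  first has a fixed length.\<close>

lemma scheme_add:
  assumes "scheme K B1 M1 l1" "scheme K B2 M2 l2"
  shows "scheme K (B1 + B2) (M1 + M2) (\<lambda>d. l1 d + l2 d)"
proof -
  obtain C1 C2 where C1: "excess_placement K B1 C1"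
      "\<And>j. j \<in> {1..K} \<Longrightarrow> (\<Sum>i\<in>{1..K} - {j}. card (C1 i j)) \<le> M1"
      "\<And>d. d permutes {1..K} \<Longrightarrow> \<exists>L\<le>l1 d. \<exists>X. delivery K B1 C1 d L X"
    and C2: "excess_placement K B2 C2"
      "\<And>j. j \<in> {1..K} \<Longrightarrow> (\<Sum>i\<in>{1..K} - {j}. card (C2 i j)) \<le> M2"
      "\<And>d. d permutes {1..K} \<Longrightarrow> \<exists>L\<le>l2 d. \<exists>X. delivery K B2 C2 d L X"
    using assms unfolding scheme_def by metis
  define C where "C i j = C1 i j \<union> (+) B1 ` C2 i j" for i j
  define front where "front F = (\<lambda>i\<in>{1..K}. take B1 (F i))" for F :: "nat \<Rightarrow> bool list"
  define rear where "rear F = (\<lambda>i\<in>{1..K}. drop B1 (F i))" for F :: "nat \<Rightarrow> bool list"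
  have C: "excess_placement K (B1 + B2) C"
    using C1(1) C2(1) unfolding excess_placement_def C_def by fastforce
  have front: "front F \<in> file_contents K B1" and rear: "rear F \<in> file_contents K B2"
    if "F \<in> file_contents K (B1 + B2)" for F
    using length_file_contents[OF that]
    by (auto simp: front_def rear_def file_contents_def bit_strings_def)
  have same: "same_cache K C1 i (front F) (front F')" "same_cache K C2 i (rear F) (rear F')"
    if i: "i \<in> {1..K}" and F: "F \<in> file_contents K (B1 + B2)" "F' \<in> file_contents K (B1 + B2)"
      and s: "same_cache K C i F F'" for i F F'
  proof -
    have own: "F i = F' i" using s by (simp add: same_cache_def)
    have cached: "F j ! b = F' j ! b" if "j \<in> {1..K}" "j \<noteq> i" "b \<in> C j i" for j b
      using s that by (simp add: same_cache_def)
    have "take B1 (F j) ! b = take B1 (F' j) ! b"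
      if j: "j \<in> {1..K}" "j \<noteq> i" and b: "b \<in> C1 j i" for j b
    proof -
      have "b < B1" using C1(1) i j b unfolding excess_placement_def by blast
      then show ?thesis using cached[OF j, of b] b by (simp add: C_def)
    qed
    then show "same_cache K C1 i (front F) (front F')"
      using i own by (simp add: same_cache_def front_def)
    have "drop B1 (F j) ! b = drop B1 (F' j) ! b"
      if j: "j \<in> {1..K}" "j \<noteq> i" and b: "b \<in> C2 j i" for j b
      using cached[OF j, of "B1 + b"] b length_file_contents[OF F(1) j(1)]
        length_file_contents[OF F(2) j(1)] by (simp add: C_def)
    then show "same_cache K C2 i (rear F) (rear F')"
      using i own by (simp add: same_cache_def rear_def)
  qed
  have "(\<Sum>i\<in>{1..K} - {j}. card (C i j)) \<le> M1 + M2" if j: "j \<in> {1..K}" for j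
  proof -
    have "card (C i j) \<le> card (C1 i j) + card (C2 i j)" for i
      unfolding C_def using card_Un_le[of "C1 i j" "(+) B1 ` C2 i j"]
      by (simp add: card_image)
    then have "(\<Sum>i\<in>{1..K} - {j}. card (C i j)) \<le>
        (\<Sum>i\<in>{1..K} - {j}. card (C1 i j) + card (C2 i j))"
      by (intro sum_mono)
    then show ?thesis using C1(2)[OF j] C2(2)[OF j] by (simp add: sum.distrib)
  qed
  moreover have "\<exists>L\<le>l1 d + l2 d. \<exists>X. delivery K (B1 + B2) C d L X" if d: "d permutes {1..K}" for d
  proof -
    obtain L1 X1 where X1: "L1 \<le> l1 d" "delivery K B1 C1 d L1 X1" using C1(3)[OF d] by blast
    obtain L2 X2 where X2: "L2 \<le> l2 d" "delivery K B2 C2 d L2 X2" using C2(3)[OF d] by blast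
    note D1 = X1(2)[unfolded delivery_iff[OF C1(1)]]
    note D2 = X2(2)[unfolded delivery_iff[OF C2(1)]]
    have len1: "length (X1 (front F)) = L1" and len2: "length (X2 (rear F)) = L2"
      if "F \<in> file_contents K (B1 + B2)" for F
      using D1 D2 front[OF that] rear[OF that] by (auto simp: bit_strings_def)
    have "delivery K (B1 + B2) C d (L1 + L2) (\<lambda>F. X1 (front F) @ X2 (rear F))"
      unfolding delivery_iff[OF C]
    proof (intro conjI ballI impI)
      show "(\<lambda>F. X1 (front F) @ X2 (rear F)) \<in> file_contents K (B1 + B2) \<rightarrow> bit_strings (L1 + L2)"
        using len1 len2 by (auto simp: bit_strings_def)
    next
      fix i F F'
      assume i: "i \<in> {1..K}"
        and F: "F \<in> file_contents K (B1 + B2)" "F' \<in> file_contents K (B1 + B2)"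
        and eq: "X1 (front F) @ X2 (rear F) = X1 (front F') @ X2 (rear F')"
        and s: "same_cache K C i F F'"
      have di: "d i \<in> {1..K}" using d i permutes_in_image by metis
      have "X1 (front F) = X1 (front F')" "X2 (rear F) = X2 (rear F')"
        using eq len1 F by auto
      then have "front F (d i) = front F' (d i)" "rear F (d i) = rear F' (d i)"
        using D1 D2 i front[OF F(1)] front[OF F(2)] rear[OF F(1)] rear[OF F(2)] same[OF i F s]
        by blast+
      then show "F (d i) = F' (d i)"
        using di unfolding front_def rear_def by (metis append_take_drop_id restrict_apply')
    qed
    then show ?thesis using X1(1) X2(1) add_mono by blast
  qed
  ultimately show ?thesis unfolding scheme_def using C by blast
qed

lemma scheme_mult:
  assumes "scheme K B M l"
  shows "scheme K (n * B) (n * M) (\<lambda>d. n * l d)"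
  by (induction n) (use assms scheme_empty scheme_add[OF assms] in auto)

section \<open>The scheme at a corner point\<close>

text \<open>Arc \<open>j\<close> is the only arc leaving vertex \<open>j\<close>, so a walk is
  forced to follow \<open>inv d\<close>. For \<open>v = u\<close> the three facts confine its arcs
  to \<open>u\<close> and its orbit and make them closed under \<open>inv d\<close>.\<close>

lemma closed_walk_file_transition_graph:
  assumes "pre_digraph.cas (file_transition_graph K d) u p v" "p \<noteq> []"
  shows "hd p = u" "\<And>x. x \<in> set p \<Longrightarrow> inv d x \<in> insert v (set p)"
    "\<And>x. x \<in> set p \<Longrightarrow> x = u \<or> x \<in> orbit (inv d) u"
proof -
  have "hd p = u \<and> (\<forall>x\<in>set p. inv d x \<in> insert v (set p)) \<and>
      (\<forall>x\<in>set p. x = u \<or> x \<in> orbit (inv d) u)"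
    using assms
  proof (induction p arbitrary: u)
    case (Cons e es)
    have e: "e = u" and es: "pre_digraph.cas (file_transition_graph K d) (inv d e) es v"
      using Cons.prems by (auto simp: pre_digraph.cas.simps file_transition_graph_def)
    show ?case
    proof (cases "es = []")
      case True
      then show ?thesis using e es by (simp add: pre_digraph.cas.simps)
    next
      case False
      have "x = inv d u \<or> x \<in> orbit (inv d) (inv d u) \<Longrightarrow> x \<in> orbit (inv d) u" for x
        by (auto intro: orbit.base orbit_subset)
      then show ?thesis using Cons.IH[OF es False] False e by (auto dest: hd_in_set)
    qed
  qed simp
  then show "hd p = u" "\<And>x. x \<in> set p \<Longrightarrow> inv d x \<in> insert v (set p)"
    "\<And>x. x \<in> set p \<Longrightarrow> x = u \<or> x \<in> orbit (inv d) u" by auto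
qed

text \<open>The arcs of a cycle form an orbit. An upper bound is the useful direction: the scheme
  saves according to the number of orbits, and more orbits save more.\<close>

lemma num_cycles_le_card_orbits:
  assumes d: "d permutes {1..K}"
  shows "num_cycles (file_transition_graph K d) \<le> card (orbit d ` {1..K})"
proof -
  have perm: "permutation d" using d permutation_permutes by blast
  have "set p \<in> orbit d ` {1..K}" if cycle: "pre_digraph.cycle (file_transition_graph K d) p" for p
  proof -
    obtain u where u: "u \<in> {1..K}" and cas: "pre_digraph.cas (file_transition_graph K d) u p u"
      and p: "p \<noteq> []"
      using cycle unfolding pre_digraph.cycle_def pre_digraph.awalk_def
      by (metis file_transition_graph_def pre_digraph.select_convs(1))
    note walk = closed_walk_file_transition_graph[OF cas p]
    have inv: "orbit (inv d) u = orbit d u" using orbit_inv_eq[OF perm] .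
    have up: "u \<in> set p" using walk(1) p by (auto dest: hd_in_set)
    have "set p \<subseteq> orbit d u"
      using walk(3) permutation_self_in_orbit[OF perm] inv by auto
    moreover have "x \<in> set p" if "x \<in> orbit (inv d) u" for x
      using that by induction (metis walk(2) up insertE)+
    ultimately show ?thesis using u inv by auto
  qed
  then show ?thesis unfolding num_cycles_def by (intro card_mono) auto
qed

text \<open>With \<open>A\<close> the workers other than \<open>i\<close> and
  \<open>t = s - 1\<close>, this gives the share \<open>(s - 1) / (K - 1)\<close> of file
  \<open>i\<close> that worker \<open>j\<close> caches, in total \<open>s - 1\<close> files'
  worth.\<close>

lemma card_subsets_containing:
  assumes A: "finite A" "j \<in> A"
  shows "card A * card {G. G \<subseteq> A \<and> card G = t \<and> j \<in> G} = t * (card A choose t)"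
proof (cases t)
  case 0
  then have empty: "{G. G \<subseteq> A \<and> card G = t \<and> j \<in> G} = {}"
    using A finite_subset by fastforce
  show ?thesis unfolding empty by (simp add: 0)
next
  case (Suc r)
  obtain n where n: "card A = Suc n" using A by (metis card_Suc_Diff1)
  have fin: "finite G" if "G \<subseteq> A" for G using A that finite_subset by blast
  have "bij_betw (insert j) {G. G \<subseteq> A - {j} \<and> card G = r} {G. G \<subseteq> A \<and> card G = t \<and> j \<in> G}"
  proof (rule bij_betwI[where g = "\<lambda>G. G - {j}"])
    show "insert j \<in> {G. G \<subseteq> A - {j} \<and> card G = r} \<rightarrow> {G. G \<subseteq> A \<and> card G = t \<and> j \<in> G}"
    proof (rule funcsetI, clarify, intro conjI)
      fix G assume G: "G \<subseteq> A - {j}" "r = card G"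
      show "insert j G \<subseteq> A" using G A by auto
      have "finite G" "j \<notin> G" using G fin[of G] by auto
      then show "card (insert j G) = t" using Suc G by simp
    qed auto
    show "(\<lambda>G. G - {j}) \<in> {G. G \<subseteq> A \<and> card G = t \<and> j \<in> G} \<rightarrow> {G. G \<subseteq> A - {j} \<and> card G = r}"
      using Suc by auto
  qed auto
  then have "card {G. G \<subseteq> A \<and> card G = t \<and> j \<in> G} = card {G. G \<subseteq> A - {j} \<and> card G = r}"
    by (rule bij_betw_same_card[symmetric])
  also have "\<dots> = n choose r" using A n by (subst n_subsets) auto
  finally have card: "card {G. G \<subseteq> A \<and> card G = t \<and> j \<in> G} = n choose r" .
  show ?thesis unfolding card unfolding n Suc by (rule Suc_times_binomial[symmetric])
qed

lemma scheme_corner: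
  assumes s: "s \<in> {1..K}"
  shows "scheme K ((K - 1) choose (s - 1)) ((s - 1) * ((K - 1) choose (s - 1)))
    (\<lambda>d. ((K - 1) choose s) - ((num_cycles (file_transition_graph K d) - 1) choose s))"
proof -
  define V where "V = {1..K}"
  define B where "B = (K - 1) choose (s - 1)"
  define Sub where "Sub i = {G. G \<subseteq> V - {i} \<and> card G = s - 1}" for i
  have V: "finite V" "card V = K" "1 \<in> V" using s by (auto simp: V_def)
  have "\<exists>e. bij_betw e (Sub i) {..<B}" if "i \<in> V" for i
  proof -
    have "card (Sub i) = B"
      using V that unfolding Sub_def B_def by (subst n_subsets) auto
    moreover have "finite (Sub i)"
      using V unfolding Sub_def by (auto intro: rev_finite_subset[of "Pow V"])
    ultimately show ?thesis using finite_same_card_bij[of "Sub i" "{..<B}"] by simp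
  qed
  \<comment> \<open>\<open>e i\<close> numbers the subfiles of file \<open>i\<close>, each being the
    single bit at that position.\<close>
  then obtain e where e: "\<And>i. i \<in> V \<Longrightarrow> bij_betw (e i) (Sub i) {..<B}" by metis
  define C where "C i j = e i ` {G \<in> Sub i. j \<in> G}" for i j
  have C: "excess_placement K B C"
    unfolding excess_placement_def C_def V_def[symmetric]
    using bij_betw_imp_surj_on[OF e] by blast
  have "(\<Sum>i\<in>V - {j}. card (C i j)) \<le> (s - 1) * B" if j: "j \<in> V" for j
  proof -
    have "(K - 1) * card (C i j) = (s - 1) * B" if i: "i \<in> V - {j}" for i
    proof -
      have "card (C i j) = card {G \<in> Sub i. j \<in> G}"
        unfolding C_def using e[of i] i by (intro card_image) (auto simp: bij_betw_def inj_on_def)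
      also have "{G \<in> Sub i. j \<in> G} = {G. G \<subseteq> V - {i} \<and> card G = s - 1 \<and> j \<in> G}"
        by (auto simp: Sub_def)
      finally show ?thesis
        using card_subsets_containing[of "V - {i}" j "s - 1"] V i j by (simp add: B_def)
    qed
    then have "(K - 1) * (\<Sum>i\<in>V - {j}. card (C i j)) = (K - 1) * ((s - 1) * B)"
      using V j by (simp add: sum_distrib_left)
    \<comment> \<open>The factor \<open>K - 1\<close> cancels unless \<open>K = 1\<close>, and then
      there is no other file.\<close>
    then show ?thesis using s j by (cases "K = 1") (auto simp: V_def)
  qed
  moreover have "\<exists>L \<le> ((K - 1) choose s) - ((num_cycles (file_transition_graph K d) - 1) choose s).
      \<exists>X. delivery K B C d L X" if d: "d permutes V" for d
  proof -
    \<comment> \<open>\<open>R\<close> picks one worker from every cycle except that of worker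
      1.\<close>
    obtain R where R: "R \<subseteq> V" "inj_on (orbit d) R" "orbit d ` V - {orbit d 1} = orbit d ` R"
      using subset_image_inj[of "orbit d ` V - {orbit d 1}" "orbit d" V] by auto
    have R1: "orbit d 1 \<notin> orbit d ` R" using R(3) by blast
    then have RV: "R \<subseteq> V - {1}" using R(1) by blast
    \<comment> \<open>\<open>T\<close> indexes the messages that are broadcast.\<close>
    define T where "T = {D. D \<subseteq> V - {1} \<and> card D = s} - {D. D \<subseteq> R \<and> card D = s}"
    have finR: "finite R" using R V finite_subset by blast
    have finT: "finite T" using V unfolding T_def by (auto intro: rev_finite_subset[of "Pow V"])
    have "card T = ((K - 1) choose s) - (card R choose s)"
    proof -
      have "card T = card {D. D \<subseteq> V - {1} \<and> card D = s} - card {D. D \<subseteq> R \<and> card D = s}"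
        unfolding T_def using RV finR
        by (intro card_Diff_subset) (auto intro: rev_finite_subset[of "Pow R"])
      then show ?thesis using V finR by (simp add: n_subsets)
    qed
    moreover have "num_cycles (file_transition_graph K d) - 1 \<le> card R"
    proof -
      have "card R = card (orbit d ` V) - 1"
        using R V by (metis card_Diff_singleton card_image finite_imageI image_eqI)
      then show ?thesis
        using num_cycles_le_card_orbits[of d K] d by (simp add: V_def)
    qed
    ultimately have cardT:
      "card T \<le> ((K - 1) choose s) - ((num_cycles (file_transition_graph K d) - 1) choose s)"
      by (simp add: binomial_right_mono diff_le_mono2)
    obtain Ts where Ts: "set Ts = T" "distinct Ts"
      using finite_distinct_list[OF finT] by blast
    \<comment> \<open>The value 0 outside the actual subfiles lets the vanishing hypotheses of
      \<open>message_reveals_subfile\<close> hold for all indices.\<close>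
    define bits where
      "bits F i G = (if i \<in> V \<and> G \<in> Sub i then of_bool (F i ! e i G) else 0 :: bit)"
      for F :: "nat \<Rightarrow> bool list" and i G
    define X where "X F = map (\<lambda>D. message V d (bits F) D = 1) Ts" for F
    have "delivery K B C d (card T) X"
      unfolding delivery_iff[OF C] V_def[symmetric]
    proof (intro conjI ballI impI)
      show "X \<in> file_contents K B \<rightarrow> bit_strings (card T)"
        using distinct_card[OF Ts(2)] Ts(1) by (auto simp: X_def bit_strings_def)
    next
      fix m F F'
      assume m: "m \<in> V" and F: "F \<in> file_contents K B" "F' \<in> file_contents K B"
        and X: "X F = X F'" and same: "same_cache K C m F F'"
      \<comment> \<open>Over the field with two elements this sum is the difference of the two
        contents.\<close>
      define g where "g i G = bits F i G + bits F' i G" for i G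
      have g: "g i G = 0 \<longleftrightarrow> (i \<in> V \<and> G \<in> Sub i \<longrightarrow> F i ! e i G = F' i ! e i G)" for i G
        by (auto simp: g_def bits_def)
      have own: "F m = F' m" using same by (simp add: same_cache_def)
      show "F (d m) = F' (d m)"
      proof (cases "d m = m")
        case False
        have dm: "d m \<in> V" using d m permutes_in_image by metis
        have sent: "message V d g D = 0" if "D \<in> T" for D
        proof -
          have "(message V d (bits F) D = 1) = (message V d (bits F') D = 1)"
            using X that Ts(1) by (auto simp: X_def)
          moreover have "message V d g D = message V d (bits F) D + message V d (bits F') D"
            unfolding g_def by (rule message_add)
          ultimately show ?thesis
            by (cases "message V d (bits F) D"; cases "message V d (bits F') D") simp_all
        qed
        have all: "message V d g D = 0" if "D \<subseteq> V" "card D = s" for D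
          by (rule messages_vanish[OF V(1) d V(3) R(1,2) R1 _ that]) (auto simp: T_def intro!: sent)
        have cached: "g i G = 0" if "m \<in> G" for i G
          unfolding g
        proof (intro impI, elim conjE)
          assume i: "i \<in> V" and G: "G \<in> Sub i"
          have "i \<noteq> m" using that G by (auto simp: Sub_def)
          moreover have "e i G \<in> C i m" using that G by (auto simp: C_def)
          ultimately show "F i ! e i G = F' i ! e i G"
            using same i by (simp add: same_cache_def V_def)
        qed
        have zero: "g (d m) G = 0" if G: "G \<in> Sub (d m)" for G
        proof (cases "m \<in> G")
          \<comment> \<open>\<open>insert m G\<close> contains \<open>m\<close> but not
            \<open>d m\<close>, so its message isolates the subfile \<open>G\<close> of file
            \<open>d m\<close>.\<close>
          case mG: False
          have "finite G" using G V by (auto simp: Sub_def intro: finite_subset)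
          then have "card (insert m G) = s" using G mG s by (auto simp: Sub_def)
          then have "message V d g (insert m G) = 0"
            using G m by (intro all) (auto simp: Sub_def)
          moreover have "message V d g (insert m G) = g (d m) (insert m G - {m})"
            using G m False own cached by (intro message_reveals_subfile[OF V(1) d]) (auto simp: Sub_def g)
          ultimately show ?thesis using mG by simp
        qed (rule cached)
        show ?thesis
        proof (rule nth_equalityI)
          show "length (F (d m)) = length (F' (d m))"
            using length_file_contents[OF F(1), of "d m"] length_file_contents[OF F(2), of "d m"] dm
            by (simp add: V_def)
          fix b assume "b < length (F (d m))"
          then have "b \<in> {..<B}" using length_file_contents[OF F(1), of "d m"] dm by (simp add: V_def)
          then obtain G where G: "G \<in> Sub (d m)" "b = e (d m) G"
            using bij_betw_imp_surj_on[OF e[OF dm]] by blast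
          then show "F (d m) ! b = F' (d m) ! b" using zero[OF G(1)] dm by (simp add: g)
        qed
      qed (simp add: own)
    qed
    then show ?thesis using cardT by blast
  qed
  ultimately show ?thesis
    unfolding scheme_def using C by (auto simp: V_def B_def intro!: exI[of _ C])
qed

section \<open>Convexity of the load and memory sharing\<close>

text \<open>The forward difference \<open>a choose k\<close> increases with \<open>a\<close>, so
  each unit step away from \<open>a\<close>, up or down, has a signed change at least that of the
  line.\<close>

lemma choose_above_tangent:
  "real (a choose Suc k) + (real r - real a) * real (a choose k) \<le> real (r choose Suc k)"
proof (cases "a \<le> r")
  case True
  then show ?thesis
  proof (induction r rule: dec_induct)
    case (step r)
    have "real (a choose k) \<le> real (r choose k)"
      using step.hyps by (simp add: binomial_right_mono)
    then show ?case using step.IH by (simp add: algebra_simps)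
  qed simp
next
  case False
  then have "r \<le> a" by simp
  then show ?thesis
  proof (induction r rule: inc_induct)
    case (step r)
    have "real (r choose k) \<le> real (a choose k)"
      using step.hyps by (simp add: binomial_right_mono)
    then show ?case using step.IH by (simp add: algebra_simps)
  qed simp
qed

lemma choose_above_chord:
  "real (a choose k) + (real r - real a) * (real (Suc a choose k) - real (a choose k))
     \<le> real (r choose k)"
  using choose_above_tangent[of a _ r] by (cases k) simp_all

text \<open>
  The right-hand side depends on \<open>t\<close> only through the upper index of a binomial coefficient, in which
  binomial coefficients are convex.
\<close>

lemma choose_ratio:
  assumes "t \<le> n" "m \<le> n"
  shows "real (m choose t) / real (n choose t) = real ((n - t) choose (n - m)) / real (n choose m)"
proof (cases "t \<le> m")
  case True
  have "(n choose m) * (m choose t) = (n choose t) * ((n - t) choose (m - t))"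
    by (rule choose_mult) (use True assms in auto)
  moreover have "(n - t) choose (m - t) = (n - t) choose (n - m)"
    using binomial_symmetric[of "m - t" "n - t"] True assms by simp
  ultimately have "real (n choose m) * real (m choose t) = real (n choose t) * real ((n - t) choose (n - m))"
    by (metis of_nat_mult)
  then show ?thesis using assms by (simp add: field_simps)
next
  case False
  then have "n - t < n - m" using assms by simp
  then show ?thesis using False by (simp add: binomial_eq_0)
qed

lemma choose_diff_eq_sum:
  assumes "g \<le> n"
  shows "real (n choose Suc t) - real (g choose Suc t) = (\<Sum>m\<in>{g..<n}. real (m choose t))"
  using assms by (induction n rule: dec_induct) simp_all

lemma num_cycles_le:
  assumes "d permutes {1..K}"
  shows "num_cycles (file_transition_graph K d) \<le> K"
  using num_cycles_le_card_orbits[OF assms] card_image_le[of "{1..K}" "orbit d"] by simp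

lemma corner_load_eq_sum:
  assumes d: "d permutes {1..K}" and s: "s \<in> {1..K}"
  shows "corner_load K d s =
    (\<Sum>m\<in>{num_cycles (file_transition_graph K d) - 1..<K - 1}.
       real ((K - s) choose (K - 1 - m)) / real ((K - 1) choose m))"
proof -
  let ?g = "num_cycles (file_transition_graph K d) - 1"
  have "corner_load K d s =
      (\<Sum>m\<in>{?g..<K - 1}. real (m choose (s - 1)) / real ((K - 1) choose (s - 1)))"
    using choose_diff_eq_sum[of ?g "K - 1" "s - 1"] num_cycles_le[OF d] s
    by (simp add: corner_load_def sum_divide_distrib)
  also have "\<dots> = (\<Sum>m\<in>{?g..<K - 1}. real ((K - s) choose (K - 1 - m)) / real ((K - 1) choose m))"
  proof (rule sum.cong[OF refl])
    fix m assume "m \<in> {?g..<K - 1}"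
    moreover have "K - 1 - (s - 1) = K - s" using s by auto
    ultimately show "real (m choose (s - 1)) / real ((K - 1) choose (s - 1)) =
        real ((K - s) choose (K - 1 - m)) / real ((K - 1) choose m)"
      using s choose_ratio[of "s - 1" "K - 1" m] by auto
  qed
  finally show ?thesis .
qed

text \<open>By \<open>corner_load_eq_sum\<close> the load is a nonnegative combination of binomial
  coefficients with upper index \<open>K - s\<close>, so it inherits
  \<open>choose_above_chord\<close>.\<close>

lemma corner_load_above_chord:
  assumes d: "d permutes {1..K}" and s: "s \<in> {1..K}" "Suc s \<in> {1..K}" and t: "t \<in> {1..K}"
  shows "corner_load K d s + (real t - real s) * (corner_load K d (Suc s) - corner_load K d s)
    \<le> corner_load K d t"
proof -
  let ?I = "{num_cycles (file_transition_graph K d) - 1..<K - 1}"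
  have "real ((K - s) choose k) / c + (real t - real s) *
      (real ((K - Suc s) choose k) / c - real ((K - s) choose k) / c) \<le> real ((K - t) choose k) / c"
    if "c \<ge> 0" for k and c :: real
  proof -
    \<comment> \<open>The upper index falls as \<open>s\<close> grows: the chord from
      \<open>s\<close> to \<open>Suc s\<close> runs from \<open>Suc a\<close> down to
      \<open>a\<close>.\<close>
    define a where "a = K - Suc s"
    have Ks: "K - s = Suc a" "K - Suc s = a" using s by (auto simp: a_def)
    have "real (K - t) - real a = 1 - (real t - real s)" using s t by (simp add: a_def of_nat_diff)
    then have "real (Suc a choose k) + (real t - real s) * (real (a choose k) - real (Suc a choose k))
        \<le> real ((K - t) choose k)"
      using choose_above_chord[of a k "K - t"] by (simp only:) (simp add: algebra_simps)
    then have "(real (Suc a choose k) + (real t - real s) * (real (a choose k) - real (Suc a choose k))) / c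
        \<le> real ((K - t) choose k) / c"
      using that by (rule divide_right_mono)
    then show ?thesis unfolding Ks by (simp add: algebra_simps add_divide_distrib diff_divide_distrib)
  qed
  then have "(\<Sum>m\<in>?I. real ((K - s) choose (K - 1 - m)) / real ((K - 1) choose m) +
        (real t - real s) * (real ((K - Suc s) choose (K - 1 - m)) / real ((K - 1) choose m) -
          real ((K - s) choose (K - 1 - m)) / real ((K - 1) choose m)))
      \<le> (\<Sum>m\<in>?I. real ((K - t) choose (K - 1 - m)) / real ((K - 1) choose m))"
    by (intro sum_mono) simp
  then show ?thesis
    unfolding corner_load_eq_sum[OF d s(1)] corner_load_eq_sum[OF d s(2)] corner_load_eq_sum[OF d t]
    by (simp only: sum.distrib sum_subtractf sum_distrib_left[symmetric])
qed

text \<open>The chord spans a supporting line: the half-plane above it contains all the points and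
  hence their convex hull.\<close>

lemma chord_le_lower_convex_envelope:
  fixes f :: "nat \<Rightarrow> real"
  assumes s: "s \<in> A" "Suc s \<in> A" and \<theta>: "0 \<le> \<theta>" "\<theta> \<le> 1"
    and above: "\<And>t. t \<in> A \<Longrightarrow> f s + (real t - real s) * (f (Suc s) - f s) \<le> f t"
  shows "(1 - \<theta>) * f s + \<theta> * f (Suc s) \<le>
    lower_convex_envelope ((\<lambda>s. (real s, f s)) ` A) (real s + \<theta>)"
  unfolding lower_convex_envelope_def
proof (rule cInf_greatest)
  let ?P = "(\<lambda>s. (real s, f s)) ` A"
  \<comment> \<open>This point of the chord shows that the infimum is not over the empty
    set.\<close>
  have "(1 - \<theta>) *\<^sub>R (real s, f s) + \<theta> *\<^sub>R (real (Suc s), f (Suc s)) \<in> convex hull ?P"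
    using \<theta> by (intro convexD[OF convex_convex_hull] hull_inc imageI s) auto
  then show "{y. (real s + \<theta>, y) \<in> convex hull ?P} \<noteq> {}"
    by (auto simp: algebra_simps)
  let ?D = "f (Suc s) - f s"
  fix y assume "y \<in> {y. (real s + \<theta>, y) \<in> convex hull ?P}"
  moreover have "convex hull ?P \<subseteq> {p. inner (- ?D, 1) p \<ge> f s - real s * ?D}"
    using above by (intro hull_minimal convex_halfspace_ge) (auto simp: inner_Pair algebra_simps)
  ultimately have "inner (- ?D, 1) (real s + \<theta>, y) \<ge> f s - real s * ?D" by blast
  then show "(1 - \<theta>) * f s + \<theta> * f (Suc s) \<le> y"
    by (simp add: inner_Pair algebra_simps)
qed

section \<open>Achievability from schemes, and memory sharing\<close>

lemma achievable_if_schemes: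
  assumes "\<And>\<epsilon>. \<epsilon> > 0 \<Longrightarrow> \<exists>B>0. \<exists>M l. scheme K B M l \<and> real M \<le> (S - 1) * real B \<and>
    (\<forall>d. d permutes {1..K} \<longrightarrow> real (l d) \<le> (\<rho> d + \<epsilon>) * real B)"
  shows "achievable K S \<rho>"
  unfolding achievable_def
proof (intro allI impI)
  fix \<epsilon> :: real assume "\<epsilon> > 0"
  then obtain B M l where B: "B > 0" and scheme: "scheme K B M l" and M: "real M \<le> (S - 1) * real B"
    and l: "\<And>d. d permutes {1..K} \<Longrightarrow> real (l d) \<le> (\<rho> d + \<epsilon>) * real B"
    using assms by metis
  obtain C where C: "excess_placement K B C"
    "\<And>j. j \<in> {1..K} \<Longrightarrow> (\<Sum>i\<in>{1..K} - {j}. card (C i j)) \<le> M"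
    "\<And>d. d permutes {1..K} \<Longrightarrow> \<exists>L\<le>l d. \<exists>X. delivery K B C d L X"
    using scheme unfolding scheme_def by metis
  have "(\<Sum>i\<in>{1..K} - {j}. real (card (C i j))) \<le> (S - 1) * real B" if "j \<in> {1..K}" for j
  proof -
    have "(\<Sum>i\<in>{1..K} - {j}. real (card (C i j))) \<le> real M"
      using C(2)[OF that] by (metis of_nat_le_iff of_nat_sum)
    then show ?thesis using M by linarith
  qed
  then have "uncoded_placement K S B C"
    using C(1) unfolding uncoded_placement_def excess_placement_def by blast
  moreover have "\<exists>L X. delivery K B C d L X \<and> real L / real B \<le> \<rho> d + \<epsilon>" if d: "d permutes {1..K}" for d
  proof -
    obtain L X where "L \<le> l d" and X: "delivery K B C d L X" using C(3)[OF d] by blast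
    then have "real L \<le> (\<rho> d + \<epsilon>) * real B" using l[OF d] by linarith
    then have "real L / real B \<le> \<rho> d + \<epsilon>" using B by (simp add: divide_le_eq)
    then show ?thesis using X by blast
  qed
  ultimately show "\<exists>B>0. \<exists>C. uncoded_placement K S B C \<and>
      (\<forall>d. d permutes {1..K} \<longrightarrow> (\<exists>L X. delivery K B C d L X \<and> real L / real B \<le> \<rho> d + \<epsilon>))"
    using B by blast
qed

text \<open>There are at most \<open>K\<close> cycles, so the subtraction of naturals is not
  truncated.\<close>

lemma corner_load_eq_nat:
  assumes d: "d permutes {1..K}" and s: "s \<in> {1..K}"
  shows "real (((K - 1) choose s) - ((num_cycles (file_transition_graph K d) - 1) choose s)) =
    corner_load K d s * real ((K - 1) choose (s - 1))"
proof -
  have "(num_cycles (file_transition_graph K d) - 1) choose s \<le> (K - 1) choose s"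
    using num_cycles_le[OF d] by (intro binomial_right_mono) simp
  moreover have "(K - 1) choose (s - 1) > 0" using s by auto
  ultimately show ?thesis by (simp add: corner_load_def of_nat_diff del: binomial_eq_0_iff zero_less_binomial_iff)
qed

lemma achievable_corner:
  assumes s: "s \<in> {1..K}"
  shows "achievable K (real s) (\<lambda>d. corner_load K d s)"
proof (rule achievable_if_schemes)
  fix \<epsilon> :: real assume "\<epsilon> > 0"
  define B where "B = (K - 1) choose (s - 1)"
  define l where "l = (\<lambda>d. ((K - 1) choose s) - ((num_cycles (file_transition_graph K d) - 1) choose s))"
  have "scheme K B ((s - 1) * B) l" using scheme_corner[OF s] by (simp only: B_def l_def)
  moreover have "real ((s - 1) * B) \<le> (real s - 1) * real B"
    using s by (simp add: of_nat_diff)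
  moreover have "real (l d) \<le> (corner_load K d s + \<epsilon>) * real B" if "d permutes {1..K}" for d
    using corner_load_eq_nat[OF that s] \<open>\<epsilon> > 0\<close> by (simp add: l_def B_def distrib_right)
  moreover have "B > 0" using s by (auto simp: B_def)
  ultimately show "\<exists>B>0. \<exists>M l. scheme K B M l \<and> real M \<le> (real s - 1) * real B \<and>
      (\<forall>d. d permutes {1..K} \<longrightarrow> real (l d) \<le> (corner_load K d s + \<epsilon>) * real B)"
    by blast
qed

text \<open>A part of each file of relative length \<open>\<theta>\<close>, up to rounding, uses the
  scheme at \<open>Suc s\<close>, the rest the one at \<open>s\<close>. The split is independent of
  \<open>d\<close>.\<close>

lemma achievable_between_corners:
  assumes s: "s \<in> {1..K}" "Suc s \<in> {1..K}" and \<theta>: "0 \<le> \<theta>" "\<theta> \<le> 1"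
  shows "achievable K (real s + \<theta>) (\<lambda>d. (1 - \<theta>) * corner_load K d s + \<theta> * corner_load K d (Suc s))"
proof (rule achievable_if_schemes)
  fix \<epsilon> :: real assume \<epsilon>: "\<epsilon> > 0"
  define b where "b = (K - 1) choose (s - 1)"
  define c where "c = (K - 1) choose s"
  have b: "b > 0" and c: "c > 0" using s by (auto simp: b_def c_def)
  obtain N :: nat where N: "real c / \<epsilon> < real N" using reals_Archimedean2 by blast
  have N0: "N > 0" using N \<epsilon> by (cases N) (auto simp: divide_less_0_iff)
  \<comment> \<open>Rounding \<open>\<theta>\<close> down to \<open>k / N\<close> respects the cache size and raises the load by at most
      \<open>corner_load K d s / N \<le> c / N < \<epsilon>\<close>, uniformly in \<open>d\<close>.\<close>
  define k where "k = nat \<lfloor>\<theta> * real N\<rfloor>"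
  have k: "real k \<le> \<theta> * real N" "\<theta> * real N < real k + 1"
    using \<theta> by (auto simp: k_def)
  have kN: "k \<le> N"
    using k(1) mult_right_mono[OF \<theta>(2), of "real N"] by simp
  define l where "l t = (\<lambda>d. ((K - 1) choose t) - ((num_cycles (file_transition_graph K d) - 1) choose t))" for t
  have "scheme K b ((s - 1) * b) (l s)" "scheme K c (s * c) (l (Suc s))"
    using scheme_corner[OF s(1)] scheme_corner[OF s(2)] by (simp_all add: b_def c_def l_def)
  \<comment> \<open>The schemes have file lengths \<open>b\<close> and \<open>c\<close>; these
    multiplicities give parts in the ratio \<open>N - k\<close> to \<open>k\<close>, of total length
    \<open>N * b * c\<close>.\<close>
  then have scheme: "scheme K (((N - k) * c) * b + (k * b) * c)
      (((N - k) * c) * ((s - 1) * b) + (k * b) * (s * c))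
      (\<lambda>d. ((N - k) * c) * l s d + (k * b) * l (Suc s) d)"
    by (intro scheme_add scheme_mult)
  have diffs: "real (N - k) = real N - real k" "real (s - 1) = real s - 1"
    using kN s by auto
  have B: "real (((N - k) * c) * b + (k * b) * c) = real N * (real b * real c)"
    unfolding of_nat_add of_nat_mult diffs by algebra
  have pos: "real b * real c > 0" using b c by simp
  have "real (((N - k) * c) * ((s - 1) * b) + (k * b) * (s * c)) =
      ((real s - 1) * real N + real k) * (real b * real c)"
    unfolding of_nat_add of_nat_mult diffs by algebra
  also have "\<dots> \<le> ((real s + \<theta> - 1) * real N) * (real b * real c)"
    using k(1) pos by (intro mult_right_mono) (auto simp: algebra_simps)
  finally have M: "real (((N - k) * c) * ((s - 1) * b) + (k * b) * (s * c)) \<le>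
      (real s + \<theta> - 1) * real (((N - k) * c) * b + (k * b) * c)"
    unfolding B by (simp add: mult.assoc)
  have load: "real (((N - k) * c) * l s d + (k * b) * l (Suc s) d) \<le>
      ((1 - \<theta>) * corner_load K d s + \<theta> * corner_load K d (Suc s) + \<epsilon>) *
        real (((N - k) * c) * b + (k * b) * c)"
    if d: "d permutes {1..K}" for d
  proof -
    define x where "x = corner_load K d s"
    define y where "y = corner_load K d (Suc s)"
    have l: "real (l s d) = x * real b" "real (l (Suc s) d) = y * real c"
      using corner_load_eq_nat[OF d s(1)] corner_load_eq_nat[OF d s(2)] by (auto simp: l_def x_def y_def b_def c_def)
    have "x * real b \<ge> 0" "y * real c \<ge> 0" unfolding l[symmetric] by simp_all
    then have x: "x \<ge> 0" and y: "y \<ge> 0" using b c by (auto simp: zero_le_mult_iff)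
    \<comment> \<open>The message at \<open>s\<close> has at most \<open>(K - 1) choose s\<close>
      bits, which bounds \<open>x\<close> uniformly in \<open>d\<close>.\<close>
    have "x * real b \<le> real c" unfolding l(1)[symmetric] by (simp add: l_def c_def)
    then have xc: "x \<le> real c"
      using b x mult_left_mono[of 1 "real b" x] by simp
    have "(\<theta> * real N - real k) * (x - y) \<le> (\<theta> * real N - real k) * x"
      using k y by (intro mult_left_mono) auto
    also have "\<dots> \<le> 1 * x"
      using k x by (intro mult_right_mono) auto
    also have "\<dots> \<le> \<epsilon> * real N"
      using xc N \<epsilon> by (simp add: divide_less_eq mult.commute)
    finally have "(real N - real k) * x + real k * y \<le>
        ((1 - \<theta>) * x + \<theta> * y + \<epsilon>) * real N"
      by (simp add: algebra_simps)
    then have "((real N - real k) * x + real k * y) * (real b * real c) \<le>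
        (((1 - \<theta>) * x + \<theta> * y + \<epsilon>) * real N) * (real b * real c)"
      using pos by (intro mult_right_mono) auto
    moreover have "real (((N - k) * c) * l s d + (k * b) * l (Suc s) d) =
        ((real N - real k) * x + real k * y) * (real b * real c)"
      unfolding of_nat_add of_nat_mult diffs l by algebra
    ultimately show ?thesis unfolding B x_def y_def by (simp only: mult.assoc)
  qed
  have "((N - k) * c) * b + (k * b) * c > 0"
    using B pos N0 by (metis of_nat_0_less_iff mult_pos_pos)
  then show "\<exists>B>0. \<exists>M l. scheme K B M l \<and> real M \<le> (real s + \<theta> - 1) * real B \<and>
      (\<forall>d. d permutes {1..K} \<longrightarrow>
        real (l d) \<le> ((1 - \<theta>) * corner_load K d s + \<theta> * corner_load K d (Suc s) + \<epsilon>) * real B)"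
    using scheme M load by blast
qed

lemma achievable_mono:
  assumes "achievable K S \<rho>" "\<And>d. d permutes {1..K} \<Longrightarrow> \<rho> d \<le> \<rho>' d"
  shows "achievable K S \<rho>'"
  unfolding achievable_def
proof (intro allI impI)
  fix \<epsilon> :: real assume "\<epsilon> > 0"
  then obtain B C where B: "B > 0" "uncoded_placement K S B C"
    and C: "\<And>d. d permutes {1..K} \<Longrightarrow> \<exists>L X. delivery K B C d L X \<and> real L / real B \<le> \<rho> d + \<epsilon>"
    using assms(1) unfolding achievable_def by blast
  have "\<exists>L X. delivery K B C d L X \<and> real L / real B \<le> \<rho>' d + \<epsilon>" if "d permutes {1..K}" for d
    using C[OF that] assms(2)[OF that] by (meson add_right_mono order_trans)
  then show "\<exists>B>0. \<exists>C. uncoded_placement K S B C \<and>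
      (\<forall>d. d permutes {1..K} \<longrightarrow> (\<exists>L X. delivery K B C d L X \<and> real L / real B \<le> \<rho>' d + \<epsilon>))"
    using B by blast
qed

theorem theorem2:
  fixes K :: nat
  assumes "K \<ge> 1"
  shows "(\<forall>S\<in>{1..K}. achievable K (real S) (\<lambda>d. corner_load K d S)) \<and>
    (\<forall>S::real. 1 \<le> S \<and> S \<le> real K \<and> S \<notin> \<int> \<longrightarrow>
       achievable K S
         (\<lambda>d. lower_convex_envelope ((\<lambda>s. (real s, corner_load K d s)) ` {1..K}) S))"
proof (intro conjI ballI allI impI)
  fix S :: real assume S: "1 \<le> S \<and> S \<le> real K \<and> S \<notin> \<int>"
  define s where "s = nat \<lfloor>S\<rfloor>"
  define \<theta> where "\<theta> = S - real s"
  have \<theta>: "0 \<le> \<theta>" "\<theta> \<le> 1" using S unfolding \<theta>_def s_def by linarith+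
  \<comment> \<open>As \<open>S\<close> is not an integer, \<open>S < K\<close>, and there is a
    corner point to its right.\<close>
  have "S \<noteq> real K" using S Ints_of_nat by blast
  then have "real s < real K" using S \<theta> unfolding \<theta>_def by linarith
  moreover have "1 \<le> s" using S unfolding s_def by linarith
  ultimately have s: "s \<in> {1..K}" "Suc s \<in> {1..K}" by auto
  have "achievable K (real s + \<theta>)
      (\<lambda>d. lower_convex_envelope ((\<lambda>s. (real s, corner_load K d s)) ` {1..K}) (real s + \<theta>))"
    by (rule achievable_mono[OF achievable_between_corners[OF s \<theta>]])
      (rule chord_le_lower_convex_envelope[OF s \<theta> corner_load_above_chord[OF _ s]])
  then show "achievable K S (\<lambda>d. lower_convex_envelope ((\<lambda>s. (real s, corner_load K d s)) ` {1..K}) S)"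
    by (simp add: \<theta>_def)
qed (rule achievable_corner)

end
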